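(* Let $G_1$ be a simple connected graph with $m_1\ge1$ edges, let $v\in V(G_1)$, let $k\ge1$, and let $G=G_1\oplus_vS_{k+1}$ be the graph obtained by attaching $k$ new pendant vertices to $v$ (i.e. the 1-sum of $G_1$ with the star $S_{k+1}$ whose central vertex is identified with $v$). Then $$\mathscr{K}(G)=\frac{m_1\mathscr{K}(G_1)+k\,\mu(G_1,v)+k\left(m_1+k-\frac12\right)}{m_1+k}.$$
   Context: For a connected graph $H$, effective resistance $r_H(i,j)=(e_i-e_j)^TL^\dagger(e_i-e_j)$ with $L^\dagger$ the Moore–Penrose pseudoinverse of the Laplacian (resistance with unit resistors on edges). For connected $H$ with $m\ge1$ edges and degrees $d_i$, Kemeny's constant $\mathscr{K}(H)=\sum_j\pi_jm_{ij}$ for the simple random walk ($\pi_j=d_j/2m$, $m_{ij}$ expected hitting time, $m_{jj}=0$), equal to $\frac1{4m}\sum_{i,j}d_id_jr_H(i,j)$. Moment: $\mu(H,v)=\sum_{i\in V(H)}d_ir_H(i,v)$. $S_{k+1}$ is the star on $k+1$ vertices. *)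

theory Defs
  imports "HOL-Probability.Probability" "Graph_Theory.Graph_Theory"
begin

text \<open>
  A finite simple graph is a \<^locale>\<open>pair_graph\<close>: a finite, loop-free digraph without parallel
  arcs whose arc relation is symmetric. Each undirected edge is thus represented by two arcs.
\<close>

definition num_edges :: "'a pair_pre_digraph \<Rightarrow> nat" where
  "num_edges G = card ((\<lambda>(u, w). {u, w}) ` parcs G)"

abbreviation deg :: "'a pair_pre_digraph \<Rightarrow> 'a \<Rightarrow> nat" where
  "deg G u \<equiv> out_degree (with_proj G) u"

definition is_star :: "'a pair_pre_digraph \<Rightarrow> 'a \<Rightarrow> bool" where
  "is_star S c \<longleftrightarrow> finite (pverts S) \<and> c \<in> pverts S \<and>
     parcs S = {c} \<times> (pverts S - {c}) \<union> (pverts S - {c}) \<times> {c}"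

text \<open>The two summands are taken as graphs that already share the identified vertex, and only it.\<close>

definition is_one_sum ::
  "'a pair_pre_digraph \<Rightarrow> 'a pair_pre_digraph \<Rightarrow> 'a \<Rightarrow> 'a pair_pre_digraph \<Rightarrow> bool" where
  "is_one_sum G G1 v G2 \<longleftrightarrow> pverts G1 \<inter> pverts G2 = {v} \<and>
     pverts G = pverts G1 \<union> pverts G2 \<and> parcs G = parcs G1 \<union> parcs G2"


section \<open>Effective resistance\<close>

text \<open>
  A square matrix with rows and columns indexed by a finite set \<open>V\<close> is a function of two
  arguments; values outside \<open>V \<times> V\<close> are irrelevant. The pseudoinverse is normalised to
  vanish there, which makes it unique as a function.
\<close>

definition mat_mul :: "'a set \<Rightarrow> ('a \<Rightarrow> 'a \<Rightarrow> real) \<Rightarrow> ('a \<Rightarrow> 'a \<Rightarrow> real) \<Rightarrow> 'a \<Rightarrow> 'a \<Rightarrow> real" where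
  "mat_mul V A B = (\<lambda>a b. \<Sum>c\<in>V. A a c * B c b)"

definition is_pseudoinverse :: "'a set \<Rightarrow> ('a \<Rightarrow> 'a \<Rightarrow> real) \<Rightarrow> ('a \<Rightarrow> 'a \<Rightarrow> real) \<Rightarrow> bool" where
  "is_pseudoinverse V A X \<longleftrightarrow>
     (\<forall>a\<in>V. \<forall>b\<in>V. mat_mul V (mat_mul V A X) A a b = A a b) \<and>
     (\<forall>a\<in>V. \<forall>b\<in>V. mat_mul V (mat_mul V X A) X a b = X a b) \<and>
     (\<forall>a\<in>V. \<forall>b\<in>V. mat_mul V A X a b = mat_mul V A X b a) \<and>
     (\<forall>a\<in>V. \<forall>b\<in>V. mat_mul V X A a b = mat_mul V X A b a)"

definition pseudoinverse :: "'a set \<Rightarrow> ('a \<Rightarrow> 'a \<Rightarrow> real) \<Rightarrow> 'a \<Rightarrow> 'a \<Rightarrow> real" where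
  "pseudoinverse V A =
     (THE X. is_pseudoinverse V A X \<and> (\<forall>a b. a \<notin> V \<or> b \<notin> V \<longrightarrow> X a b = 0))"

definition laplacian :: "'a pair_pre_digraph \<Rightarrow> 'a \<Rightarrow> 'a \<Rightarrow> real" where
  "laplacian G a b =
     (if a = b then real (deg G a) else 0) - (if (a, b) \<in> parcs G then 1 else 0)"

definition unit_vec_at :: "'a \<Rightarrow> 'a \<Rightarrow> real" where
  "unit_vec_at i a = (if a = i then 1 else 0)"

definition eff_resistance :: "'a pair_pre_digraph \<Rightarrow> 'a \<Rightarrow> 'a \<Rightarrow> real" where
  "eff_resistance G i j =
     (\<Sum>a\<in>pverts G. \<Sum>b\<in>pverts G.
        (unit_vec_at i a - unit_vec_at j a) * pseudoinverse (pverts G) (laplacian G) a b *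
        (unit_vec_at i b - unit_vec_at j b))"

definition moment :: "'a pair_pre_digraph \<Rightarrow> 'a \<Rightarrow> real" where
  "moment G v = (\<Sum>i\<in>pverts G. real (deg G i) * eff_resistance G i v)"


section \<open>Simple random walk and Kemeny's constant\<close>

definition srw_step :: "'a pair_pre_digraph \<Rightarrow> 'a \<Rightarrow> 'a pmf" where
  "srw_step G u = pmf_of_set {w. (u, w) \<in> parcs G}"

text \<open>The joint law of the first \<open>n + 1\<close> positions \<open>[X\<^sub>0, \<dots>, X\<^sub>n]\<close> of the walk started at \<open>X\<^sub>0 = i\<close>.\<close>

primrec srw_path :: "'a pair_pre_digraph \<Rightarrow> nat \<Rightarrow> 'a \<Rightarrow> 'a list pmf" where
  "srw_path G 0 i = return_pmf [i]"
| "srw_path G (Suc n) i = bind_pmf (srw_step G i) (\<lambda>w. map_pmf ((#) i) (srw_path G n w))"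

text \<open>The probability that the hitting time \<open>min {n. X\<^sub>n = j}\<close> of \<open>j\<close> equals \<open>n\<close>.\<close>

definition hit_prob :: "'a pair_pre_digraph \<Rightarrow> 'a \<Rightarrow> 'a \<Rightarrow> nat \<Rightarrow> real" where
  "hit_prob G i j n =
     measure_pmf.prob (srw_path G n i) {xs. xs ! n = j \<and> (\<forall>l<n. xs ! l \<noteq> j)}"

text \<open>
  On a finite connected graph with an edge the hitting time is almost surely finite and the
  series converges; on other graphs the value is not meaningful.
\<close>

definition exp_hit_time :: "'a pair_pre_digraph \<Rightarrow> 'a \<Rightarrow> 'a \<Rightarrow> real" where
  "exp_hit_time G i j = (\<Sum>n. real n * hit_prob G i j n)"

definition stationary :: "'a pair_pre_digraph \<Rightarrow> 'a \<Rightarrow> real" where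
  "stationary G j = real (deg G j) / (2 * real (num_edges G))"

text \<open>The sum is the same for every starting vertex \<open>i\<close>; Kemeny's constant is this common value.\<close>

definition kemeny :: "'a pair_pre_digraph \<Rightarrow> real" where
  "kemeny G =
     (THE K. \<forall>i\<in>pverts G. K = (\<Sum>j\<in>pverts G. stationary G j * exp_hit_time G i j))"

end

theory Submission
  imports Defs
begin

text \<open>
  Every step rests on one fact: the hitting times \<open>h(\<cdot>, j)\<close> of a connected graph with \<open>m\<close> edges are
  the solution of \<open>L h = d - 2 m e\<^sub>j\<close> vanishing at \<open>j\<close>, and such solutions are unique by the maximum
  principle. Hence \<open>\<Sum>\<^sub>j d\<^sub>j h(i, j)\<close> is harmonic in \<open>i\<close>, so Kemeny's constant may be computed from
  any start; the pseudoinverse of \<open>L\<close> is a combination of hitting times; and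
  \<open>2 m r(i, j) = h(i, j) + h(j, i)\<close>. Starting the walk on \<open>G\<close> at \<open>v\<close>, a pendant vertex is hit after
  \<open>2 (m\<^sub>1 + k) - 1\<close> steps on average, while for \<open>j\<close> in \<open>G\<^sub>1\<close> the excursions to pendant vertices add
  \<open>2 k r(v, j)\<close> to the hitting time in \<open>G\<^sub>1\<close>.
\<close>

section \<open>Laplacian and maximum principle\<close>

definition nbrs :: "'a pair_pre_digraph \<Rightarrow> 'a \<Rightarrow> 'a set" where
  "nbrs G u = {w. (u, w) \<in> parcs G}"

text \<open>The Laplacian acts here on functions, since hitting-time equations and comparison
  arguments are pointwise; \<open>sum_laplacian_mult\<close> links it to the matrix.\<close>

definition lap_op :: "'a pair_pre_digraph \<Rightarrow> ('a \<Rightarrow> real) \<Rightarrow> 'a \<Rightarrow> real" where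
  "lap_op G f u = real (deg G u) * f u - (\<Sum>w\<in>nbrs G u. f w)"

lemma deg_eq_card_nbrs: "deg G u = card (nbrs G u)"
proof -
  have "out_arcs (with_proj G) u = Pair u ` nbrs G u"
    by (auto simp: out_arcs_def nbrs_def)
  then show ?thesis
    by (simp add: out_degree_def card_image inj_on_def)
qed

lemma lap_op_add: "lap_op G (\<lambda>x. f x + g x) u = lap_op G f u + lap_op G g u"
  by (simp add: lap_op_def sum.distrib algebra_simps)

lemma lap_op_diff: "lap_op G (\<lambda>x. f x - g x) u = lap_op G f u - lap_op G g u"
  by (simp add: lap_op_def sum_subtractf algebra_simps)

lemma lap_op_cmult: "lap_op G (\<lambda>x. c * f x) u = c * lap_op G f u"
  by (simp add: lap_op_def sum_distrib_left algebra_simps)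

lemma lap_op_const: "lap_op G (\<lambda>x. c) u = 0"
  by (simp add: lap_op_def deg_eq_card_nbrs)

lemma lap_op_sum: "lap_op G (\<lambda>x. \<Sum>i\<in>I. f i x) u = (\<Sum>i\<in>I. lap_op G (f i) u)"
proof -
  have "(\<Sum>w\<in>nbrs G u. \<Sum>i\<in>I. f i w) = (\<Sum>i\<in>I. \<Sum>w\<in>nbrs G u. f i w)"
    by (rule sum.swap)
  then show ?thesis
    by (simp add: lap_op_def sum_subtractf sum_distrib_left)
qed

text \<open>Connectedness is phrased as plain reachability along arcs. Having an arc excludes the
  one-vertex graph, so every vertex has a neighbour and a step of the walk is well defined.\<close>

locale connected_simple_graph =
  fixes G :: "'a pair_pre_digraph"
  assumes finite_verts: "finite (pverts G)"
    and arcs_subset: "parcs G \<subseteq> pverts G \<times> pverts G"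
    and sym_arcs: "sym (parcs G)"
    and irrefl_arcs: "irrefl (parcs G)"
    and reach: "\<lbrakk>i \<in> pverts G; j \<in> pverts G\<rbrakk> \<Longrightarrow> (i, j) \<in> (parcs G)\<^sup>*"
    and arcs_nonempty: "parcs G \<noteq> {}"
begin

abbreviation "V \<equiv> pverts G"

lemma nbrs_subset: "nbrs G u \<subseteq> V"
  using arcs_subset by (auto simp: nbrs_def)

lemma finite_nbrs: "finite (nbrs G u)"
  using nbrs_subset finite_verts by (rule finite_subset)

lemma nbrs_sym: "w \<in> nbrs G u \<longleftrightarrow> u \<in> nbrs G w"
  using sym_arcs by (auto simp: nbrs_def dest: symD)

lemma nbrs_nonempty:
  assumes "u \<in> V"
  shows "nbrs G u \<noteq> {}"
proof -
  obtain a b where ab: "(a, b) \<in> parcs G"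
    using arcs_nonempty by auto
  have "(b, a) \<in> parcs G"
    using ab sym_arcs by (auto dest: symD)
  show ?thesis
  proof (cases "u = a")
    case True
    then show ?thesis using ab by (auto simp: nbrs_def)
  next
    case False
    have "(u, a) \<in> (parcs G)\<^sup>*"
      using reach assms ab arcs_subset by auto
    from this False show ?thesis
      by (cases rule: converse_rtranclE) (auto simp: nbrs_def)
  qed
qed

lemma deg_pos: "u \<in> V \<Longrightarrow> 0 < deg G u"
  using nbrs_nonempty finite_nbrs by (simp add: deg_eq_card_nbrs card_gt_0_iff)

text \<open>Double counting of arcs: symmetry and the absence of loops make the fibre over each edge
  consist of exactly two arcs.\<close>

lemma sum_deg_eq: "(\<Sum>u\<in>V. real (deg G u)) = 2 * real (num_edges G)"
proof -
  let ?e = "\<lambda>(u, w). {u, w} :: 'a set"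
  have fin: "finite (parcs G)"
    using arcs_subset finite_verts by (meson finite_SigmaI finite_subset)
  have "parcs G = Sigma V (nbrs G)"
    using arcs_subset by (auto simp: nbrs_def)
  then have "card (parcs G) = (\<Sum>u\<in>V. deg G u)"
    by (simp add: deg_eq_card_nbrs card_SigmaI finite_verts finite_nbrs)
  moreover have "card (parcs G) = (\<Sum>e\<in>?e ` parcs G. card {a \<in> parcs G. ?e a = e})"
    using sum.image_gen[OF fin, of "\<lambda>_. 1::nat" ?e] by simp
  moreover have "card {a \<in> parcs G. ?e a = e} = 2" if "e \<in> ?e ` parcs G" for e
  proof -
    obtain u w where uw: "(u, w) \<in> parcs G" "e = {u, w}"
      using \<open>e \<in> ?e ` parcs G\<close> by auto
    then have "u \<noteq> w" "(w, u) \<in> parcs G"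
      using irrefl_arcs sym_arcs by (auto simp: irrefl_def dest: symD)
    then have "{a \<in> parcs G. ?e a = e} = {(u, w), (w, u)}"
      using uw by (auto simp: doubleton_eq_iff)
    then show ?thesis using \<open>u \<noteq> w\<close> by simp
  qed
  ultimately have "(\<Sum>u\<in>V. deg G u) = 2 * num_edges G"
    by (simp add: num_edges_def)
  then show ?thesis
    by (metis of_nat_mult of_nat_numeral of_nat_sum)
qed

lemma num_edges_pos: "0 < num_edges G"
proof -
  have "finite (parcs G)"
    using arcs_subset finite_verts by (meson finite_SigmaI finite_subset)
  then show ?thesis
    using arcs_nonempty by (simp add: num_edges_def card_gt_0_iff)
qed

lemma lap_op_cong:
  assumes "u \<in> V" and "\<And>x. x \<in> V \<Longrightarrow> f x = g x"
  shows "lap_op G f u = lap_op G g u"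
proof -
  have "(\<Sum>w\<in>nbrs G u. f w) = (\<Sum>w\<in>nbrs G u. g w)"
    using nbrs_subset assms(2) by (intro sum.cong) auto
  then show ?thesis
    using assms by (simp add: lap_op_def)
qed

text \<open>Adjacency is symmetric, so the double sum over adjacent pairs may be exchanged.\<close>

lemma lap_op_self_adjoint:
  "(\<Sum>u\<in>V. g u * lap_op G f u) = (\<Sum>u\<in>V. f u * lap_op G g u)"
proof -
  have expand: "(\<Sum>u\<in>V. g u * (\<Sum>w\<in>nbrs G u. f w)) = (\<Sum>u\<in>V. \<Sum>w\<in>{w \<in> V. w \<in> nbrs G u}. g u * f w)"
    for f g :: "'a \<Rightarrow> real"
  proof (rule sum.cong[OF refl])
    fix u assume "u \<in> V"
    have "{w \<in> V. w \<in> nbrs G u} = nbrs G u"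
      using nbrs_subset by auto
    then show "g u * (\<Sum>w\<in>nbrs G u. f w) = (\<Sum>w\<in>{w \<in> V. w \<in> nbrs G u}. g u * f w)"
      by (simp add: sum_distrib_left)
  qed
  have "(\<Sum>u\<in>V. \<Sum>w\<in>{w \<in> V. w \<in> nbrs G u}. g u * f w)
      = (\<Sum>w\<in>V. \<Sum>u\<in>{u \<in> V. w \<in> nbrs G u}. g u * f w)"
    by (rule sum.swap_restrict) (auto simp: finite_verts)
  also have "\<dots> = (\<Sum>w\<in>V. \<Sum>u\<in>{u \<in> V. u \<in> nbrs G w}. f w * g u)"
    by (simp add: nbrs_sym mult.commute)
  finally have "(\<Sum>u\<in>V. g u * (\<Sum>w\<in>nbrs G u. f w)) = (\<Sum>w\<in>V. f w * (\<Sum>u\<in>nbrs G w. g u))"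
    by (simp add: expand)
  then show ?thesis
    by (simp add: lap_op_def right_diff_distrib sum_subtractf mult.left_commute mult.commute)
qed

lemma sum_lap_op: "(\<Sum>u\<in>V. lap_op G f u) = 0"
  using lap_op_self_adjoint[of "\<lambda>_. 1" f] by (simp add: lap_op_const)

text \<open>Away from \<open>j\<close>, \<open>f\<close> is at most its average over neighbours. A
  maximum attained there is attained at every neighbour, and so it propagates along a path to
  \<open>j\<close>.\<close>

lemma maximum_principle:
  assumes "j \<in> V" and sub: "\<And>u. u \<in> V - {j} \<Longrightarrow> lap_op G f u \<le> 0" and "i \<in> V"
  shows "f i \<le> f j"
proof -
  define M where "M = Max (f ` V)"
  have le_M: "f u \<le> M" if "u \<in> V" for u
    using that finite_verts by (simp add: M_def)
  have "M \<in> f ` V"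
    using finite_verts assms(1) unfolding M_def by (intro Max_in) auto
  then obtain x where x: "x \<in> V" "f x = M" by auto
  have step: "f w = M" if "u \<in> V" "u \<noteq> j" "f u = M" "w \<in> nbrs G u" for u w
  proof (rule ccontr)
    assume "f w \<noteq> M"
    then have "f w < M"
      using le_M[of w] nbrs_subset that(4) by fastforce
    then have "(\<Sum>w\<in>nbrs G u. f w) < (\<Sum>w\<in>nbrs G u. M)"
      using that(4) le_M nbrs_subset by (intro sum_strict_mono_ex1 finite_nbrs) auto
    then have "0 < lap_op G f u"
      using that(3) by (simp add: lap_op_def deg_eq_card_nbrs)
    then show False using sub[of u] that by auto
  qed
  have "(x, j) \<in> (parcs G)\<^sup>*" using reach x assms(1) by auto
  then have "x \<in> V \<longrightarrow> f x = M \<longrightarrow> f j = M"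
  proof (induction rule: converse_rtrancl_induct)
    case (step y z)
    show ?case
    proof (cases "y = j")
      case False
      then show ?thesis
        using step \<open>\<And>u w. \<lbrakk>u \<in> V; u \<noteq> j; f u = M; w \<in> nbrs G u\<rbrakk> \<Longrightarrow> f w = M\<close>[of y z] arcs_subset
        by (auto simp: nbrs_def)
    qed auto
  qed auto
  then show ?thesis using x le_M assms(3) by auto
qed

lemma lap_op_unique:
  assumes "j \<in> V" "i \<in> V" and "\<And>u. u \<in> V - {j} \<Longrightarrow> lap_op G f u = lap_op G g u" and "f j = g j"
  shows "f i = g i"
proof -
  have "f i - g i \<le> f j - g j"
    using assms by (intro maximum_principle[where f = "\<lambda>x. f x - g x"]) (auto simp: lap_op_diff)
  moreover have "g i - f i \<le> g j - f j"
    using assms by (intro maximum_principle[where f = "\<lambda>x. g x - f x"]) (auto simp: lap_op_diff)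
  ultimately show ?thesis using assms(4) by simp
qed

lemma harmonic_imp_constant:
  assumes "\<And>u. u \<in> V \<Longrightarrow> lap_op G f u = 0" and "i \<in> V" "j \<in> V"
  shows "f i = f j"
  using lap_op_unique[of j i f "\<lambda>_. f j"] assms by (simp add: lap_op_const)

section \<open>Distance levels and a barrier function\<close>

lemma level_function_exists:
  assumes "j \<in> V"
  obtains l :: "'a \<Rightarrow> nat"
  where "\<And>u. u \<in> V - {j} \<Longrightarrow> \<exists>w\<in>nbrs G u. l w < l u"
proof -
  \<comment> \<open>The level is the distance to \<open>j\<close>; the first arc of a shortest walk
    lowers it.\<close>
  define l where "l u = (LEAST n. (u, j) \<in> parcs G ^^ n)" for u
  have "\<exists>w\<in>nbrs G u. l w < l u" if u: "u \<in> V - {j}" for u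
  proof -
    have "\<exists>n. (u, j) \<in> parcs G ^^ n"
      using reach[of u j] u assms by (auto simp: rtrancl_power)
    then have l: "(u, j) \<in> parcs G ^^ l u"
      unfolding l_def by (rule LeastI_ex)
    obtain n where n: "l u = Suc n"
      using l u by (cases "l u") auto
    then obtain w where w: "(u, w) \<in> parcs G" "(w, j) \<in> parcs G ^^ n"
      using l by (metis relpow_Suc_D2)
    then have "l w \<le> n"
      unfolding l_def by (intro Least_le)
    then show ?thesis using w n by (auto simp: nbrs_def)
  qed
  then show thesis by (rule that)
qed

text \<open>
  The barrier is \<open>C (1 - \<epsilon>\<^sup>l)\<close> for a level function \<open>l\<close>: the neighbour on a lower level
  outweighs all the others once \<open>\<epsilon>\<close> is small compared to the inverse of the maximal degree.
\<close>

lemma barrier_exists: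
  assumes "j \<in> V"
  obtains g where "\<And>u. u \<in> V \<Longrightarrow> 0 \<le> g u" and "\<And>u. u \<in> V - {j} \<Longrightarrow> real (deg G u) \<le> lap_op G g u"
proof -
  obtain l :: "'a \<Rightarrow> nat" where l: "\<And>u. u \<in> V - {j} \<Longrightarrow> \<exists>w\<in>nbrs G u. l w < l u"
    using level_function_exists[OF assms] by blast
  define N where "N = real (card V)"
  define T where "T = Max (l ` V)"
  \<comment> \<open>The choice of \<open>\<epsilon>\<close> gives 1 - N * epsilon = 1/2. The factor
    \<open>C\<close> then leaves a surplus of at least \<open>N\<close>, hence at least the degree,
    even on the top level \<open>T\<close>.\<close>
  define \<epsilon> where "\<epsilon> = 1 / (2 * N)"
  define C where "C = 2 * N / \<epsilon> ^ T"
  define g where "g u = C * (1 - \<epsilon> ^ l u)" for u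
  have "1 \<le> N"
    unfolding N_def using finite_verts assms by (simp add: Suc_le_eq card_gt_0_iff) auto
  then have eps: "0 < \<epsilon>" "\<epsilon> \<le> 1"
    by (auto simp: \<epsilon>_def field_simps)
  have "0 < C"
    using eps \<open>1 \<le> N\<close> by (simp add: C_def)
  have nonneg: "0 \<le> g u" for u
    using eps \<open>0 < C\<close> by (simp add: g_def power_le_one)
  have "real (deg G u) \<le> lap_op G g u" if u: "u \<in> V - {j}" for u
  proof -
    let ?d = "real (deg G u)"
    obtain w where w: "w \<in> nbrs G u" "l w < l u"
      using l[OF u] by blast
    obtain n where n: "l u = Suc n"
      using w by (cases "l u") auto
    have "l u \<le> T"
      using u finite_verts by (simp add: T_def)
    have d: "?d \<le> N"
      using card_mono[OF finite_verts nbrs_subset] by (simp add: deg_eq_card_nbrs N_def)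
    \<comment> \<open>The level of another neighbour is uncontrolled, but \<open>g\<close> never
      exceeds \<open>C\<close>, which bounds the loss.\<close>
    have other: "- (C * \<epsilon> ^ Suc n) \<le> g u - g x" for x
    proof -
      have "0 \<le> C * \<epsilon> ^ l x" using eps \<open>0 < C\<close> by simp
      then show ?thesis by (simp add: g_def n algebra_simps)
    qed
    have "\<epsilon> ^ n \<le> \<epsilon> ^ l w"
      using w n eps by (intro power_decreasing) auto
    then have low: "C * \<epsilon> ^ n - C * \<epsilon> ^ Suc n \<le> g u - g w"
      using \<open>0 < C\<close> by (simp add: g_def n algebra_simps)
    have card: "real (card (nbrs G u - {w})) = ?d - 1"
      using w finite_nbrs deg_pos[of u] u by (simp add: deg_eq_card_nbrs card_Diff_singleton of_nat_diff)
    have "?d = ?d * 1" by simp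
    also have "?d * 1 \<le> N * 1" using d by simp
    also have "N * 1 \<le> N * (\<epsilon> ^ n / \<epsilon> ^ T)"
      using \<open>1 \<le> N\<close> eps \<open>l u \<le> T\<close> n
      by (intro mult_left_mono) (auto simp: divide_simps intro!: power_decreasing)
    also have "\<dots> = C * \<epsilon> ^ n * (1 - N * \<epsilon>)"
      using \<open>1 \<le> N\<close> by (simp add: C_def \<epsilon>_def)
    also have "\<dots> \<le> C * \<epsilon> ^ n * (1 - ?d * \<epsilon>)"
      using d eps \<open>0 < C\<close> by (intro mult_left_mono) auto
    also have "\<dots> = (C * \<epsilon> ^ n - C * \<epsilon> ^ Suc n) + (\<Sum>x\<in>nbrs G u - {w}. - (C * \<epsilon> ^ Suc n))"
      unfolding sum_constant card by (simp add: algebra_simps)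
    also have "\<dots> \<le> (g u - g w) + (\<Sum>x\<in>nbrs G u - {w}. g u - g x)"
      by (intro add_mono low sum_mono other)
    also have "\<dots> = (\<Sum>x\<in>nbrs G u. g u - g x)"
      using sum.remove[OF finite_nbrs w(1), of "\<lambda>x. g u - g x"] by simp
    also have "\<dots> = lap_op G g u"
      by (simp add: lap_op_def deg_eq_card_nbrs sum_subtractf)
    finally show ?thesis .
  qed
  with nonneg show thesis by (rule that)
qed

end

section \<open>Hitting times\<close>

lemma measure_bind_pmf_of_set:
  assumes "finite A" "A \<noteq> {}"
  shows "measure_pmf.prob (bind_pmf (pmf_of_set A) f) X = (\<Sum>x\<in>A. measure_pmf.prob (f x) X) / real (card A)"
proof -
  have int: "integrable (measure_pmf (pmf_of_set A)) (\<lambda>x. measure_pmf.prob (f x) X)"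
    using assms by (intro integrable_measure_pmf_finite) simp
  have "ennreal (measure_pmf.prob (bind_pmf (pmf_of_set A) f) X)
      = (\<integral>\<^sup>+x. ennreal (measure_pmf.prob (f x) X) \<partial>measure_pmf (pmf_of_set A))"
    by (simp flip: measure_pmf.emeasure_eq_measure)
  also have "\<dots> = ennreal (\<integral>x. measure_pmf.prob (f x) X \<partial>measure_pmf (pmf_of_set A))"
    using int by (intro nn_integral_eq_integral) auto
  also have "\<dots> = ennreal ((\<Sum>x\<in>A. measure_pmf.prob (f x) X) / real (card A))"
    using assms by (simp add: integral_pmf_of_set)
  finally show ?thesis
    by (subst (asm) ennreal_inj) (auto intro!: divide_nonneg_nonneg sum_nonneg)
qed

lemma hit_prob_0: "hit_prob G i j 0 = (if i = j then 1 else 0)"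
  by (simp add: hit_prob_def)

lemma hit_prob_nonneg: "0 \<le> hit_prob G i j n"
  by (simp add: hit_prob_def)

lemma hit_prob_self_Suc: "hit_prob G j j (Suc n) = 0"
  unfolding hit_prob_def measure_pmf_zero_iff by auto

lemma exp_hit_time_self: "exp_hit_time G j j = 0"
proof -
  have "real n * hit_prob G j j n = 0" for n
    by (cases n) (simp_all add: hit_prob_self_Suc)
  then show ?thesis by (simp only: exp_hit_time_def suminf_zero)
qed

context connected_simple_graph
begin

text \<open>First-step analysis, multiplied by the degree to match the form of
  \<open>lap_op\<close>.\<close>

lemma hit_prob_Suc:
  assumes "i \<in> V" "i \<noteq> j"
  shows "real (deg G i) * hit_prob G i j (Suc n) = (\<Sum>w\<in>nbrs G i. hit_prob G w j n)"
proof -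
  \<comment> \<open>As \<open>i\<close> differs from \<open>j\<close>, the condition at time 0 holds
    automatically and the event merely shifts by one.\<close>
  have "(#) i -` {xs. xs ! Suc n = j \<and> (\<forall>l<Suc n. xs ! l \<noteq> j)} = {xs. xs ! n = j \<and> (\<forall>l<n. xs ! l \<noteq> j)}"
    using assms(2) by (auto simp: less_Suc_eq_0_disj)
  moreover have "srw_step G i = pmf_of_set (nbrs G i)"
    by (simp add: srw_step_def nbrs_def)
  ultimately have "hit_prob G i j (Suc n) = (\<Sum>w\<in>nbrs G i. hit_prob G w j n) / real (card (nbrs G i))"
    unfolding hit_prob_def srw_path.simps
    by (simp only: measure_bind_pmf_of_set[OF finite_nbrs nbrs_nonempty[OF assms(1)]] measure_map_pmf)
  then show ?thesis
    using deg_pos[OF assms(1)] by (simp add: deg_eq_card_nbrs)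
qed

text \<open>The events for different \<open>n\<close> live under different path laws, so
  disjointness cannot be invoked directly; the bound goes by induction through the first
  step.\<close>

lemma sum_hit_prob_le_1: "i \<in> V \<Longrightarrow> (\<Sum>n<N. hit_prob G i j n) \<le> 1"
proof (induction N arbitrary: i)
  case (Suc N)
  show ?case
  proof (cases "i = j")
    case True
    then show ?thesis
      by (simp only: sum.lessThan_Suc_shift) (simp add: hit_prob_0 hit_prob_self_Suc)
  next
    case False
    have "real (deg G i) * (\<Sum>n<Suc N. hit_prob G i j n)
        = (\<Sum>n<N. real (deg G i) * hit_prob G i j (Suc n))"
      using False by (simp only: sum.lessThan_Suc_shift) (simp add: hit_prob_0 sum_distrib_left)
    also have "\<dots> = (\<Sum>n<N. \<Sum>w\<in>nbrs G i. hit_prob G w j n)"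
      by (simp only: hit_prob_Suc[OF Suc.prems False])
    also have "\<dots> = (\<Sum>w\<in>nbrs G i. \<Sum>n<N. hit_prob G w j n)"
      by (rule sum.swap)
    also have "\<dots> \<le> (\<Sum>w\<in>nbrs G i. 1)"
      using Suc.IH nbrs_subset by (intro sum_mono) auto
    also have "\<dots> = real (deg G i) * 1"
      by (simp add: deg_eq_card_nbrs)
    finally show ?thesis
      using deg_pos[OF Suc.prems] by (subst (asm) mult_le_cancel_left_pos) auto
  qed
qed simp

lemma summable_hit_prob: "i \<in> V \<Longrightarrow> summable (hit_prob G i j)"
  using hit_prob_nonneg sum_hit_prob_le_1 by (intro summableI_nonneg_bounded[where x = 1]) auto

text \<open>The total hitting probability is harmonic off \<open>j\<close> and equals 1 at
  \<open>j\<close>, so uniqueness identifies it with the constant 1.\<close>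

lemma suminf_hit_prob:
  assumes "i \<in> V" "j \<in> V"
  shows "(\<Sum>n. hit_prob G i j n) = 1"
proof -
  let ?q = "\<lambda>i. \<Sum>n. hit_prob G i j n"
  have "lap_op G ?q u = 0" if u: "u \<in> V - {j}" for u
  proof -
    have "?q u = (\<Sum>n. hit_prob G u j (Suc n))"
      using suminf_split_head[OF summable_hit_prob, of u j] u by (simp add: hit_prob_0)
    then have "real (deg G u) * ?q u = (\<Sum>n. real (deg G u) * hit_prob G u j (Suc n))"
      using summable_hit_prob[of u j] u by (subst suminf_mult) (auto simp: summable_Suc_iff)
    also have "\<dots> = (\<Sum>n. \<Sum>w\<in>nbrs G u. hit_prob G w j n)"
      using u by (subst hit_prob_Suc) auto
    also have "\<dots> = (\<Sum>w\<in>nbrs G u. ?q w)"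
      using summable_hit_prob nbrs_subset by (intro suminf_sum) auto
    finally show ?thesis by (simp add: lap_op_def)
  qed
  moreover have "?q j = 1"
    using suminf_split_head[OF summable_hit_prob, of j j] assms(2)
    by (simp add: hit_prob_0 hit_prob_self_Suc)
  ultimately show ?thesis
    using lap_op_unique[of j i ?q "\<lambda>_. 1"] assms by (simp add: lap_op_const)
qed

text \<open>The truncated expectations satisfy a first-step recursion in which each step costs at
  most 1. The barrier is a supersolution of that recursion, so by induction it bounds them
  all.\<close>

lemma summable_hit_time:
  assumes "i \<in> V" "j \<in> V"
  shows "summable (\<lambda>n. real n * hit_prob G i j n)"
proof -
  obtain g where g: "\<And>u. u \<in> V \<Longrightarrow> 0 \<le> g u" "\<And>u. u \<in> V - {j} \<Longrightarrow> real (deg G u) \<le> lap_op G g u"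
    using barrier_exists[OF assms(2)] by blast
  have "(\<Sum>n<N. real n * hit_prob G u j n) \<le> g u" if "u \<in> V" for u N
    using that
  proof (induction N arbitrary: u)
    case 0
    then show ?case using g(1) by simp
  next
    case (Suc N)
    show ?case
    proof (cases "u = j")
      case True
      then show ?thesis
        using g(1)[OF Suc.prems]
        by (simp only: sum.lessThan_Suc_shift) (simp add: hit_prob_self_Suc)
    next
      case False
      have "real (deg G u) * (\<Sum>n<Suc N. real n * hit_prob G u j n)
          = (\<Sum>n<N. real (Suc n) * (real (deg G u) * hit_prob G u j (Suc n)))"
        by (simp only: sum.lessThan_Suc_shift) (simp add: sum_distrib_left mult.left_commute)
      also have "\<dots> = (\<Sum>n<N. \<Sum>w\<in>nbrs G u. real n * hit_prob G w j n + hit_prob G w j n)"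
        by (simp only: hit_prob_Suc[OF Suc.prems False]) (simp add: sum_distrib_left algebra_simps)
      also have "\<dots> = (\<Sum>w\<in>nbrs G u. \<Sum>n<N. real n * hit_prob G w j n + hit_prob G w j n)"
        by (rule sum.swap)
      also have "\<dots> \<le> (\<Sum>w\<in>nbrs G u. g w + 1)"
        unfolding sum.distrib[of _ _ "{..<N}"]
        using nbrs_subset[of u] by (intro sum_mono add_mono Suc.IH sum_hit_prob_le_1) auto
      also have "\<dots> = (\<Sum>w\<in>nbrs G u. g w) + real (deg G u)"
        by (simp add: sum.distrib deg_eq_card_nbrs)
      also have "\<dots> \<le> real (deg G u) * g u"
        using g(2)[of u] Suc.prems False by (simp add: lap_op_def)
      finally show ?thesis
        using deg_pos[OF Suc.prems] by (subst (asm) mult_le_cancel_left_pos) auto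
    qed
  qed
  then show ?thesis
    using assms
    by (intro summableI_nonneg_bounded[where x = "g i"] mult_nonneg_nonneg hit_prob_nonneg) auto
qed

text \<open>Splitting n + 1 into n and 1 after the first step yields the hitting time of the
  neighbour plus its total hitting probability, which is 1.\<close>

lemma lap_op_exp_hit_time_off:
  assumes "u \<in> V - {j}" "j \<in> V"
  shows "lap_op G (\<lambda>i. exp_hit_time G i j) u = real (deg G u)"
proof -
  have u: "u \<in> V" "u \<noteq> j" using assms by auto
  have sm: "summable (\<lambda>n. real (Suc n) * hit_prob G u j (Suc n))"
    using summable_hit_time[OF u(1) assms(2)]
    by (subst summable_Suc_iff[of "\<lambda>n. real n * hit_prob G u j n"])
  have "exp_hit_time G u j = (\<Sum>n. real (Suc n) * hit_prob G u j (Suc n))"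
    unfolding exp_hit_time_def
    using suminf_split_head[OF summable_hit_time[OF u(1) assms(2)]] by simp
  then have "real (deg G u) * exp_hit_time G u j
      = (\<Sum>n. real (Suc n) * (real (deg G u) * hit_prob G u j (Suc n)))"
    using suminf_mult[OF sm, of "real (deg G u)"] by (simp add: mult.left_commute)
  also have "\<dots> = (\<Sum>n. \<Sum>w\<in>nbrs G u. real n * hit_prob G w j n + hit_prob G w j n)"
    by (simp only: hit_prob_Suc[OF u]) (simp add: sum_distrib_left algebra_simps)
  also have "\<dots> = (\<Sum>w\<in>nbrs G u. \<Sum>n. real n * hit_prob G w j n + hit_prob G w j n)"
    using nbrs_subset assms(2)
    by (intro suminf_sum summable_add summable_hit_time summable_hit_prob) auto
  also have "\<dots> = (\<Sum>w\<in>nbrs G u. exp_hit_time G w j + 1)"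
  proof (rule sum.cong[OF refl])
    fix w assume "w \<in> nbrs G u"
    then have "w \<in> V" using nbrs_subset by auto
    then show "(\<Sum>n. real n * hit_prob G w j n + hit_prob G w j n) = exp_hit_time G w j + 1"
      using suminf_add[OF summable_hit_time summable_hit_prob, of w j w j] suminf_hit_prob[of w j] assms(2)
      by (simp add: exp_hit_time_def)
  qed
  finally show ?thesis
    by (simp add: lap_op_def sum.distrib deg_eq_card_nbrs)
qed

text \<open>At \<open>j\<close> itself the value is forced: the Laplacian of any function sums to 0,
  while the degrees sum to 2m.\<close>

lemma lap_op_exp_hit_time:
  assumes "u \<in> V" "j \<in> V"
  shows "lap_op G (\<lambda>i. exp_hit_time G i j) u
    = real (deg G u) - (if u = j then 2 * real (num_edges G) else 0)"
proof (cases "u = j")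
  case True
  let ?f = "lap_op G (\<lambda>i. exp_hit_time G i j)"
  have "(\<Sum>x\<in>V - {j}. ?f x) = (\<Sum>x\<in>V - {j}. real (deg G x))"
    using assms(2) by (intro sum.cong) (auto simp: lap_op_exp_hit_time_off)
  moreover have "?f j + (\<Sum>x\<in>V - {j}. ?f x) = 0"
    using sum_lap_op[of "\<lambda>i. exp_hit_time G i j"] sum.remove[OF finite_verts assms(2), of ?f] by simp
  moreover have "real (deg G j) + (\<Sum>x\<in>V - {j}. real (deg G x)) = 2 * real (num_edges G)"
    using sum_deg_eq sum.remove[OF finite_verts assms(2), of "\<lambda>x. real (deg G x)"] by simp
  ultimately show ?thesis using True by simp
qed (use assms lap_op_exp_hit_time_off in auto)

section \<open>Kemeny's constant from an arbitrary starting vertex\<close>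

lemma kemeny_eq:
  assumes "i \<in> V"
  shows "2 * real (num_edges G) * kemeny G = (\<Sum>j\<in>V. real (deg G j) * exp_hit_time G i j)"
proof -
  define K where "K i = (\<Sum>j\<in>V. stationary G j * exp_hit_time G i j)" for i
  \<comment> \<open>The weights sum to 1, and 2m times the weight of \<open>u\<close> is its degree,
    so both contributions cancel. The resulting constancy makes the description in
    \<open>kemeny\<close> definite.\<close>
  have "lap_op G K u = 0" if "u \<in> V" for u
  proof -
    have "lap_op G K u = (\<Sum>j\<in>V. stationary G j * lap_op G (\<lambda>i. exp_hit_time G i j) u)"
      unfolding K_def by (simp add: lap_op_sum lap_op_cmult)
    also have "\<dots> = (\<Sum>j\<in>V. stationary G j * real (deg G u)
        - (if u = j then 2 * real (num_edges G) * stationary G j else 0))"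
      using that by (intro sum.cong) (auto simp: lap_op_exp_hit_time algebra_simps)
    also have "\<dots> = (\<Sum>j\<in>V. stationary G j) * real (deg G u) - 2 * real (num_edges G) * stationary G u"
      using that finite_verts by (simp add: sum_subtractf sum_distrib_right sum.delta')
    also have "(\<Sum>j\<in>V. stationary G j) = 1"
      using num_edges_pos by (simp add: stationary_def sum_deg_eq flip: sum_divide_distrib)
    finally show ?thesis
      using num_edges_pos by (simp add: stationary_def)
  qed
  then have "K a = K b" if "a \<in> V" "b \<in> V" for a b
    using harmonic_imp_constant that by blast
  then have "kemeny G = K i"
    unfolding kemeny_def K_def[symmetric] using assms by (intro the_equality) blast+
  then show ?thesis
    using num_edges_pos by (simp add: K_def stationary_def sum_distrib_left)
qed

end

section \<open>Pseudoinverse of the Laplacian\<close>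

lemma mat_mul_assoc: "mat_mul V (mat_mul V A B) C = mat_mul V A (mat_mul V B C)"
proof (intro ext)
  fix a b
  have "(\<Sum>c\<in>V. \<Sum>d\<in>V. A a d * B d c * C c b) = (\<Sum>d\<in>V. \<Sum>c\<in>V. A a d * B d c * C c b)"
    by (rule sum.swap)
  then show "mat_mul V (mat_mul V A B) C a b = mat_mul V A (mat_mul V B C) a b"
    by (simp add: mat_mul_def sum_distrib_left sum_distrib_right mult.assoc)
qed

text \<open>Matrix identities hold only on \<open>V\<close>, not as equations between functions, so
  factors have to be replaced entrywise.\<close>

lemma mat_mul_cong:
  assumes "\<And>c. c \<in> V \<Longrightarrow> A a c = A' a c" and "\<And>c. c \<in> V \<Longrightarrow> B c b = B' c b"
  shows "mat_mul V A B a b = mat_mul V A' B' a b"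
  unfolding mat_mul_def using assms by (intro sum.cong) auto

lemma mat_mul_symmetric_swap:
  assumes "a \<in> V" "b \<in> V"
    and "\<And>c d. \<lbrakk>c \<in> V; d \<in> V\<rbrakk> \<Longrightarrow> P c d = P d c"
    and "\<And>c d. \<lbrakk>c \<in> V; d \<in> V\<rbrakk> \<Longrightarrow> Q c d = Q d c"
  shows "mat_mul V P Q a b = mat_mul V Q P b a"
  unfolding mat_mul_def using assms by (intro sum.cong) (auto simp: mult.commute)

lemma is_pseudoinverse_unique:
  assumes X: "is_pseudoinverse V A X" and Y: "is_pseudoinverse V A Y" and "a \<in> V" "b \<in> V"
  shows "X a b = Y a b"
proof -
  let ?m = "mat_mul V"
  note Xd = X[unfolded is_pseudoinverse_def] and Yd = Y[unfolded is_pseudoinverse_def]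
  \<comment> \<open>Penrose's argument: AX = (AY)(AX) is the transpose of (AX)(AY) = AY, and AY is
    symmetric.\<close>
  have AX_AY: "?m A X c d = ?m A Y c d" if cd: "c \<in> V" "d \<in> V" for c d
  proof -
    have "?m A X c d = ?m (?m (?m A Y) A) X c d"
      using Yd cd by (intro mat_mul_cong) auto
    also have "\<dots> = ?m (?m A Y) (?m A X) c d"
      by (simp add: mat_mul_assoc)
    also have "\<dots> = ?m (?m A X) (?m A Y) d c"
      using Xd Yd cd by (intro mat_mul_symmetric_swap) auto
    also have "\<dots> = ?m (?m (?m A X) A) Y d c"
      by (simp add: mat_mul_assoc)
    also have "\<dots> = ?m A Y d c"
      using Xd cd by (intro mat_mul_cong) auto
    finally show ?thesis using Yd cd by simp
  qed
  have XA_YA: "?m X A c d = ?m Y A c d" if cd: "c \<in> V" "d \<in> V" for c d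
  proof -
    have "?m X A c d = ?m X (?m (?m A Y) A) c d"
      using Yd cd by (intro mat_mul_cong) auto
    also have "\<dots> = ?m (?m X A) (?m Y A) c d"
      by (simp add: mat_mul_assoc)
    also have "\<dots> = ?m (?m Y A) (?m X A) d c"
      using Xd Yd cd by (intro mat_mul_symmetric_swap) auto
    also have "\<dots> = ?m Y (?m (?m A X) A) d c"
      by (simp add: mat_mul_assoc)
    also have "\<dots> = ?m Y A d c"
      using Xd cd by (intro mat_mul_cong) auto
    finally show ?thesis using Yd cd by simp
  qed
  have "X a b = ?m X (?m A X) a b"
    using Xd assms(3,4) by (simp add: mat_mul_assoc)
  also have "\<dots> = ?m X (?m A Y) a b"
    using AX_AY assms(3,4) by (intro mat_mul_cong[of V X a X]) auto
  also have "\<dots> = ?m (?m X A) Y a b"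
    by (simp add: mat_mul_assoc)
  also have "\<dots> = ?m (?m Y A) Y a b"
    using XA_YA assms(3,4) by (intro mat_mul_cong[of V _ a _ Y]) auto
  also have "\<dots> = Y a b"
    using Yd assms(3,4) by simp
  finally show ?thesis .
qed

lemma pseudoinverse_eq:
  assumes "is_pseudoinverse V A X" "a \<in> V" "b \<in> V"
  shows "pseudoinverse V A a b = X a b"
proof -
  \<comment> \<open>Cutting off outside \<open>V\<close> keeps the Penrose equations and produces
    the normalised representative that \<open>pseudoinverse\<close> selects.\<close>
  define X' where "X' a b = (if a \<in> V \<and> b \<in> V then X a b else 0)" for a b
  have "mat_mul V A X' a b = mat_mul V A X a b" "mat_mul V X' A a b = mat_mul V X A a b"
    if "a \<in> V" "b \<in> V" for a b
    using that by (auto intro!: mat_mul_cong simp: X'_def)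
  moreover have "mat_mul V (mat_mul V A X') A a b = mat_mul V (mat_mul V A X) A a b"
    "mat_mul V (mat_mul V X' A) X' a b = mat_mul V (mat_mul V X A) X a b"
    if "a \<in> V" "b \<in> V" for a b
    using that calculation by (auto intro!: mat_mul_cong simp: X'_def)
  ultimately have X': "is_pseudoinverse V A X'"
    using assms(1) by (simp add: is_pseudoinverse_def X'_def)
  have "pseudoinverse V A = X'"
    unfolding pseudoinverse_def
  proof (rule the_equality)
    show "is_pseudoinverse V A X' \<and> (\<forall>a b. a \<notin> V \<or> b \<notin> V \<longrightarrow> X' a b = 0)"
      using X' by (auto simp: X'_def)
  next
    fix Y assume Y: "is_pseudoinverse V A Y \<and> (\<forall>a b. a \<notin> V \<or> b \<notin> V \<longrightarrow> Y a b = 0)"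
    show "Y = X'"
    proof (intro ext)
      fix a b
      show "Y a b = X' a b"
        using Y is_pseudoinverse_unique[OF _ X', of Y a b] by (cases "a \<in> V \<and> b \<in> V") (auto simp: X'_def)
    qed
  qed
  then show ?thesis using assms(2,3) by (simp add: X'_def)
qed

section \<open>Green functions and the commute time identity\<close>

context connected_simple_graph
begin

lemma sum_laplacian_mult:
  assumes "a \<in> V"
  shows "(\<Sum>c\<in>V. laplacian G a c * f c) = lap_op G f a"
proof -
  have "(\<Sum>c\<in>V. laplacian G a c * f c)
      = (\<Sum>c\<in>V. (if a = c then real (deg G a) * f c else 0) - (if c \<in> nbrs G a then f c else 0))"
    by (intro sum.cong) (auto simp: laplacian_def nbrs_def left_diff_distrib)
  also have "\<dots> = real (deg G a) * f a - (\<Sum>c\<in>V \<inter> nbrs G a. f c)"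
    using assms finite_verts by (simp add: sum_subtractf sum.delta' sum.inter_restrict)
  also have "V \<inter> nbrs G a = nbrs G a"
    using nbrs_subset by auto
  finally show ?thesis by (simp add: lap_op_def)
qed

lemma laplacian_sym: "laplacian G a b = laplacian G b a"
  using sym_arcs by (auto simp: laplacian_def dest: symD)

lemma mat_mul_laplacian_left:
  "a \<in> V \<Longrightarrow> mat_mul V (laplacian G) X a b = lap_op G (\<lambda>c. X c b) a"
  by (simp add: mat_mul_def sum_laplacian_mult)

lemma mat_mul_laplacian_right:
  "b \<in> V \<Longrightarrow> mat_mul V X (laplacian G) a b = lap_op G (X a) b"
  using sum_laplacian_mult[of b "X a"] by (simp add: mat_mul_def laplacian_sym[of _ b] mult.commute)

text \<open>This is the action of the projection I - J/n (J all ones, n the number of vertices),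
  which removes the mean.\<close>

lemma sum_centering:
  assumes "a \<in> V"
  shows "(\<Sum>c\<in>V. ((if a = c then 1 else 0) - 1 / real (card V)) * f c)
    = f a - (\<Sum>c\<in>V. f c) / real (card V)"
proof -
  have "(\<Sum>c\<in>V. ((if a = c then 1 else 0) - 1 / real (card V)) * f c)
      = (\<Sum>c\<in>V. (if a = c then f c else 0) - f c / real (card V))"
    by (intro sum.cong) (auto simp: left_diff_distrib)
  then show ?thesis
    using assms finite_verts by (simp add: sum_subtractf sum.delta' sum_divide_distrib)
qed

text \<open>Averaging the differences of hitting times over all targets solves the Poisson equation.\<close>

lemma green_function_exists:
  assumes "b \<in> V"
  obtains g where "\<And>a. a \<in> V \<Longrightarrow> lap_op G g a = (if a = b then 1 else 0) - 1 / real (card V)"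
    and "(\<Sum>a\<in>V. g a) = 0"
proof -
  define n where "n = real (card V)"
  define m where "m = real (num_edges G)"
  define h where "h = exp_hit_time G"
  have n: "n > 0"
    unfolding n_def using assms finite_verts by (auto simp: card_gt_0_iff)
  have m: "m > 0"
    unfolding m_def using num_edges_pos by simp
  \<comment> \<open>The degrees cancel in h(.,i) - h(.,b), leaving a source 2m at \<open>b\<close>
    and a sink 2m at \<open>i\<close>; averaging over \<open>i\<close> spreads the sink
    evenly.\<close>
  define g0 where "g0 a = (1 / (2 * m * n)) * (\<Sum>i\<in>V. h a i - h a b)" for a
  \<comment> \<open>Removing the mean leaves the Laplacian unchanged and gives the zero sum needed
    for XLX = X.\<close>
  define g where "g a = g0 a - (\<Sum>c\<in>V. g0 c) / n" for a
  have "lap_op G g a = (if a = b then 1 else 0) - 1 / n" if "a \<in> V" for a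
  proof -
    have "lap_op G g a = lap_op G g0 a"
      unfolding g_def by (simp add: lap_op_diff lap_op_const)
    also have "\<dots> = (1 / (2 * m * n)) * (\<Sum>i\<in>V. lap_op G (\<lambda>x. h x i) a - lap_op G (\<lambda>x. h x b) a)"
      unfolding g0_def by (simp only: lap_op_cmult lap_op_sum lap_op_diff)
    also have "(\<Sum>i\<in>V. lap_op G (\<lambda>x. h x i) a - lap_op G (\<lambda>x. h x b) a)
        = (\<Sum>i\<in>V. (if a = b then 2 * m else 0) - (if a = i then 2 * m else 0))"
      using that assms by (intro sum.cong) (auto simp: h_def m_def lap_op_exp_hit_time)
    also have "\<dots> = n * (if a = b then 2 * m else 0) - 2 * m"
      using that finite_verts by (simp add: sum_subtractf sum.delta' n_def)
    also have "(1 / (2 * m * n)) * (n * (if a = b then 2 * m else 0) - 2 * m) = (if a = b then 1 else 0) - 1 / n"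
      using n m by (cases "a = b") (simp_all add: field_simps)
    finally show ?thesis .
  qed
  moreover have "(\<Sum>a\<in>V. g a) = 0"
    using n by (simp add: g_def sum_subtractf n_def)
  ultimately show thesis
    unfolding n_def by (rule that)
qed

text \<open>With Green functions as columns, LX and XL both equal the centering projection. It fixes
  \<open>L\<close> and \<open>X\<close>, whose columns sum to 0.\<close>

lemma laplacian_pseudoinverse_exists:
  obtains X where "is_pseudoinverse V (laplacian G) X"
    and "\<And>a b. \<lbrakk>a \<in> V; b \<in> V\<rbrakk> \<Longrightarrow> lap_op G (\<lambda>c. X c b) a = (if a = b then 1 else 0) - 1 / real (card V)"
proof -
  have "\<forall>b\<in>V. \<exists>g. (\<forall>a\<in>V. lap_op G g a = (if a = b then 1 else 0) - 1 / real (card V)) \<and> (\<Sum>a\<in>V. g a) = 0"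
    using green_function_exists by metis
  then obtain g where g: "\<And>a b. \<lbrakk>a \<in> V; b \<in> V\<rbrakk> \<Longrightarrow> lap_op G (g b) a = (if a = b then 1 else 0) - 1 / real (card V)"
    and g0: "\<And>b. b \<in> V \<Longrightarrow> (\<Sum>a\<in>V. g b a) = 0"
    by (auto simp: bchoice_iff)
  define D :: "'a \<Rightarrow> 'a \<Rightarrow> real" where "D a b = (if a = b then 1 else 0) - 1 / real (card V)" for a b
  define X where "X a b = g b a" for a b
  have D_sym: "D a b = D b a" for a b
    by (auto simp: D_def)
  \<comment> \<open>Pairing two Green functions through the Laplacian evaluates one of them at a
    point; self-adjointness then makes \<open>X\<close> symmetric.\<close>
  have pair: "(\<Sum>u\<in>V. g a u * lap_op G (g b) u) = g a b" if "a \<in> V" "b \<in> V" for a b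
  proof -
    have "(\<Sum>u\<in>V. g a u * lap_op G (g b) u) = (\<Sum>u\<in>V. ((if b = u then 1 else 0) - 1 / real (card V)) * g a u)"
      using that g by (intro sum.cong) auto
    then show ?thesis
      using sum_centering[OF that(2), of "g a"] g0[OF that(1)] by simp
  qed
  have X_sym: "X a b = X b a" if "a \<in> V" "b \<in> V" for a b
    using pair[OF that] pair[OF that(2,1)] lap_op_self_adjoint[of "g a" "g b"] by (simp add: X_def)
  have LX: "mat_mul V (laplacian G) X a b = D a b" if "a \<in> V" "b \<in> V" for a b
    using that g by (simp add: mat_mul_laplacian_left X_def D_def)
  have XL: "mat_mul V X (laplacian G) a b = D a b" if "a \<in> V" "b \<in> V" for a b
  proof -
    have "mat_mul V X (laplacian G) a b = lap_op G (X a) b"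
      using that by (simp add: mat_mul_laplacian_right)
    also have "\<dots> = lap_op G (g a) b"
      using that X_sym by (intro lap_op_cong) (auto simp: X_def)
    finally show ?thesis
      using g[OF that(2,1)] by (simp add: D_def)
  qed
  have "mat_mul V (mat_mul V (laplacian G) X) (laplacian G) a b = laplacian G a b" if "a \<in> V" "b \<in> V" for a b
  proof -
    have "mat_mul V (mat_mul V (laplacian G) X) (laplacian G) a b = mat_mul V D (laplacian G) a b"
      using that LX by (intro mat_mul_cong) auto
    also have "\<dots> = laplacian G a b - (\<Sum>c\<in>V. laplacian G c b) / real (card V)"
      using sum_centering[OF that(1), of "\<lambda>c. laplacian G c b"] by (simp add: mat_mul_def D_def)
    also have "(\<Sum>c\<in>V. laplacian G c b) = 0"
      using sum_laplacian_mult[OF that(2), of "\<lambda>_. 1"] by (simp add: lap_op_const laplacian_sym[of _ b])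
    finally show ?thesis by simp
  qed
  moreover have "mat_mul V (mat_mul V X (laplacian G)) X a b = X a b" if "a \<in> V" "b \<in> V" for a b
  proof -
    have "mat_mul V (mat_mul V X (laplacian G)) X a b = mat_mul V D X a b"
      using that XL by (intro mat_mul_cong) auto
    also have "\<dots> = X a b - (\<Sum>c\<in>V. X c b) / real (card V)"
      using sum_centering[OF that(1), of "\<lambda>c. X c b"] by (simp add: mat_mul_def D_def)
    finally show ?thesis
      using g0[OF that(2)] by (simp add: X_def)
  qed
  ultimately have "is_pseudoinverse V (laplacian G) X"
    unfolding is_pseudoinverse_def using LX XL D_sym by auto
  then show thesis
    using g by (intro that) (auto simp: X_def)
qed

lemma eff_resistance_eq_commute_time:
  assumes "i \<in> V" "j \<in> V"
  shows "2 * real (num_edges G) * eff_resistance G i j = exp_hit_time G i j + exp_hit_time G j i"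
proof -
  define m where "m = real (num_edges G)"
  have m: "m > 0"
    unfolding m_def using num_edges_pos by simp
  obtain X where X: "is_pseudoinverse V (laplacian G) X"
    and lapX: "\<And>a b. \<lbrakk>a \<in> V; b \<in> V\<rbrakk> \<Longrightarrow> lap_op G (\<lambda>c. X c b) a = (if a = b then 1 else 0) - 1 / real (card V)"
    using laplacian_pseudoinverse_exists by blast
  \<comment> \<open>Both differences have Laplacian 2m at \<open>i\<close>, -2m at \<open>j\<close>
    and 0 elsewhere, so \<open>f\<close> is harmonic. Comparing its values at \<open>i\<close> and
    \<open>j\<close> gives the commute time.\<close>
  define f where "f a = 2 * m * (X a i - X a j) - (exp_hit_time G a j - exp_hit_time G a i)" for a
  have "lap_op G f u = 0" if "u \<in> V" for u
    unfolding f_def lap_op_diff lap_op_cmult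
    using that assms by (simp add: lapX lap_op_exp_hit_time m_def)
  then have "f i = f j"
    using harmonic_imp_constant assms by blast
  then have *: "2 * m * ((X i i - X i j) - (X j i - X j j)) = exp_hit_time G i j + exp_hit_time G j i"
    by (simp add: f_def exp_hit_time_self right_diff_distrib)
  have "eff_resistance G i j
      = (\<Sum>a\<in>V. \<Sum>b\<in>V. (unit_vec_at i a - unit_vec_at j a) * X a b * (unit_vec_at i b - unit_vec_at j b))"
    unfolding eff_resistance_def using pseudoinverse_eq[OF X] by (intro sum.cong) auto
  also have "\<dots> = (\<Sum>a\<in>V. (unit_vec_at i a - unit_vec_at j a) * (X a i - X a j))"
  proof (rule sum.cong[OF refl])
    fix a
    have "(\<Sum>b\<in>V. (unit_vec_at i a - unit_vec_at j a) * X a b * (unit_vec_at i b - unit_vec_at j b))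
        = (unit_vec_at i a - unit_vec_at j a) * (\<Sum>b\<in>V. (if b = i then X a b else 0) - (if b = j then X a b else 0))"
      unfolding sum_distrib_left by (intro sum.cong) (auto simp: unit_vec_at_def)
    then show "(\<Sum>b\<in>V. (unit_vec_at i a - unit_vec_at j a) * X a b * (unit_vec_at i b - unit_vec_at j b))
        = (unit_vec_at i a - unit_vec_at j a) * (X a i - X a j)"
      using assms finite_verts by (simp add: sum_subtractf)
  qed
  also have "\<dots> = (\<Sum>a\<in>V. (if a = i then X a i - X a j else 0) - (if a = j then X a i - X a j else 0))"
    by (intro sum.cong) (auto simp: unit_vec_at_def)
  also have "\<dots> = (X i i - X i j) - (X j i - X j j)"
    using assms finite_verts by (simp add: sum_subtractf)
  finally show ?thesis
    using * by (simp add: m_def)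
qed

end

section \<open>Attaching pendant vertices\<close>

lemma pair_graph_connected_simple_graph:
  assumes "pair_graph G" "Digraph_Component.connected (with_proj G)" "parcs G \<noteq> {}"
  shows "connected_simple_graph G"
proof -
  interpret pair_graph G by fact
  have sym: "sym (parcs G)"
    using pair_sym_arcs by (simp add: symmetric_def)
  \<comment> \<open>Connectedness refers to the symmetric closure, which adds nothing to a symmetric
    arc relation.\<close>
  have "parcs (mk_symmetric (with_proj G)) = parcs G"
    using sym by (auto simp: parcs_mk_symmetric dest: symD)
  then have "(i, j) \<in> (parcs G)\<^sup>*" if "i \<in> pverts G" "j \<in> pverts G" for i j
    using assms(2) that rtrancl_on_rtranclI[of i j "pverts G" "parcs G"]
    by (simp add: Digraph_Component.connected_def strongly_connected_def reachable_def)
  moreover have "irrefl (parcs G)"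
    using pair_no_loops by (fastforce simp: irrefl_def)
  moreover have "parcs G \<subseteq> pverts G \<times> pverts G"
    using arc_fst_in_verts arc_snd_in_verts by fastforce
  ultimately show ?thesis
    using sym pair_finite_verts assms(3) by unfold_locales
qed

text \<open>The star enters through its leaves \<open>P\<close> alone, which makes the vertex set a
  disjoint union.\<close>

locale pendant_extension = H: connected_simple_graph G1
  for G1 :: "'a pair_pre_digraph" +
  fixes G :: "'a pair_pre_digraph" and v :: 'a and P :: "'a set"
  assumes v: "v \<in> pverts G1"
    and finite_P: "finite P"
    and disjoint: "P \<inter> pverts G1 = {}"
    and verts_G: "pverts G = pverts G1 \<union> P"
    and arcs_G: "parcs G = parcs G1 \<union> ({v} \<times> P \<union> P \<times> {v})"
begin

sublocale connected_simple_graph G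
proof
  show "finite (pverts G)"
    using H.finite_verts finite_P verts_G by simp
  show "parcs G \<subseteq> pverts G \<times> pverts G"
    using H.arcs_subset v verts_G arcs_G by auto
  show "sym (parcs G)"
    using H.sym_arcs arcs_G by (auto simp: sym_def)
  show "irrefl (parcs G)"
    using H.irrefl_arcs arcs_G disjoint v by (auto simp: irrefl_def)
  show "parcs G \<noteq> {}"
    using H.arcs_nonempty arcs_G by auto
  have mono: "(parcs G1)\<^sup>* \<subseteq> (parcs G)\<^sup>*"
    using arcs_G by (intro rtrancl_mono) auto
  have "(i, v) \<in> (parcs G)\<^sup>* \<and> (v, i) \<in> (parcs G)\<^sup>*" if "i \<in> pverts G" for i
    using that mono H.reach[of i v] H.reach[of v i] v verts_G arcs_G by (auto intro: r_into_rtrancl)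
  then show "(i, j) \<in> (parcs G)\<^sup>*" if "i \<in> pverts G" "j \<in> pverts G" for i j
    using that by (meson rtrancl_trans)
qed

lemma nbrs_old: "\<lbrakk>u \<in> pverts G1; u \<noteq> v\<rbrakk> \<Longrightarrow> nbrs G u = nbrs G1 u"
  using disjoint by (auto simp: nbrs_def arcs_G)

lemma nbrs_center: "nbrs G v = nbrs G1 v \<union> P"
  using disjoint v by (auto simp: nbrs_def arcs_G)

lemma nbrs_pendant: "p \<in> P \<Longrightarrow> nbrs G p = {v}"
  using disjoint v H.arcs_subset by (auto simp: nbrs_def arcs_G)

lemma nbrs_center_disjoint: "nbrs G1 v \<inter> P = {}"
  using H.nbrs_subset disjoint by blast

lemma deg_G:
  shows deg_old: "\<lbrakk>u \<in> pverts G1; u \<noteq> v\<rbrakk> \<Longrightarrow> deg G u = deg G1 u"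
    and deg_center: "deg G v = deg G1 v + card P"
    and deg_pendant: "p \<in> P \<Longrightarrow> deg G p = 1"
  by (simp_all add: deg_eq_card_nbrs nbrs_old nbrs_center nbrs_pendant card_Un_disjoint
      nbrs_center_disjoint H.finite_nbrs finite_P)

text \<open>Attaching the leaves raises the degree of \<open>v\<close> by their number and adds
  vertices of degree 1. The constant 1 gives the edge count, hitting times give Kemeny's
  constant.\<close>

lemma sum_deg_mult:
  "(\<Sum>j\<in>pverts G. real (deg G j) * f j)
    = (\<Sum>j\<in>pverts G1. real (deg G1 j) * f j) + real (card P) * f v + (\<Sum>p\<in>P. f p)"
proof -
  have "(\<Sum>j\<in>pverts G. real (deg G j) * f j)
      = (\<Sum>j\<in>pverts G1. real (deg G j) * f j) + (\<Sum>p\<in>P. real (deg G p) * f p)"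
    unfolding verts_G using disjoint H.finite_verts finite_P by (intro sum.union_disjoint) auto
  also have "(\<Sum>p\<in>P. real (deg G p) * f p) = (\<Sum>p\<in>P. f p)"
    by (simp add: deg_pendant)
  also have "(\<Sum>j\<in>pverts G1. real (deg G j) * f j)
      = (\<Sum>j\<in>pverts G1. real (deg G1 j) * f j + (if j = v then real (card P) * f j else 0))"
    by (intro sum.cong) (auto simp: deg_old deg_center algebra_simps)
  also have "\<dots> = (\<Sum>j\<in>pverts G1. real (deg G1 j) * f j) + real (card P) * f v"
    using v H.finite_verts by (simp add: sum.distrib)
  finally show ?thesis .
qed

lemma num_edges_G: "num_edges G = num_edges G1 + card P"
proof -
  have "2 * real (num_edges G) = 2 * real (num_edges G1) + 2 * real (card P)"
    using sum_deg_eq H.sum_deg_eq sum_deg_mult[of "\<lambda>_. 1"] by simp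
  then show ?thesis by linarith
qed

lemma exp_hit_time_from_pendant:
  assumes "p \<in> P" "j \<in> V" "j \<noteq> p"
  shows "exp_hit_time G p j = 1 + exp_hit_time G v j"
  using lap_op_exp_hit_time[of p j] assms verts_G
  by (simp add: lap_op_def nbrs_pendant deg_pendant)

text \<open>At the target \<open>p\<close>, whose only neighbour is \<open>v\<close>, the Laplacian
  equation reads -h(v,p) = 1 - 2m with m the edge count of \<open>G\<close>.\<close>

lemma exp_hit_time_to_pendant:
  assumes "p \<in> P"
  shows "exp_hit_time G v p = 2 * real (num_edges G) - 1"
  using lap_op_exp_hit_time[of p p] assms verts_G
  by (simp add: lap_op_def nbrs_pendant deg_pendant exp_hit_time_self)

text \<open>
  Each excursion into a pendant vertex costs two steps, so for the hitting times of \<open>j\<close> the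
  pendant vertices act as an extra source of strength \<open>2k\<close> at \<open>v\<close>.
\<close>

lemma exp_hit_time_to_old:
  assumes j: "j \<in> pverts G1"
  shows "exp_hit_time G v j = exp_hit_time G1 v j + 2 * real (card P) * eff_resistance G1 v j"
proof -
  define m where "m = real (num_edges G1)"
  define c where "c = real (card P) / m"
  define h where "h = exp_hit_time G1"
  have m: "m > 0"
    unfolding m_def using H.num_edges_pos by simp
  \<comment> \<open>The difference h(.,j) - h(.,v) has Laplacian 2m at \<open>v\<close> and 0
    elsewhere off \<open>j\<close>, so the factor \<open>c\<close> scales it to 2k; the constant
    h(j,v) makes the correction vanish at \<open>j\<close>.\<close>
  have "lap_op G1 (\<lambda>x. exp_hit_time G x j) u
      = lap_op G1 (\<lambda>x. h x j + c * (h x j - h x v + h j v)) u"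
    if u: "u \<in> pverts G1 - {j}" for u
  proof -
    have "lap_op G1 (\<lambda>x. h x j + c * (h x j - h x v + h j v)) u
        = real (deg G1 u) + (if u = v then 2 * real (card P) else 0)"
      unfolding lap_op_add lap_op_cmult lap_op_diff lap_op_const
      using u j v m by (auto simp: h_def H.lap_op_exp_hit_time c_def m_def)
    moreover have "lap_op G1 (\<lambda>x. exp_hit_time G x j) u
        = real (deg G1 u) + (if u = v then 2 * real (card P) else 0)"
    proof (cases "u = v")
      case False
      then have "lap_op G1 (\<lambda>x. exp_hit_time G x j) u = lap_op G (\<lambda>x. exp_hit_time G x j) u"
        using u by (simp add: lap_op_def nbrs_old deg_old)
      then show ?thesis
        using u j False verts_G by (simp add: lap_op_exp_hit_time deg_old)
    next
      case True
      \<comment> \<open>Each leaf contributes h(v,j) - h(p,j) = -1 to the Laplacian of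
        \<open>G\<close> at \<open>v\<close> and adds 1 to the degree there; together this is the
        extra 2k.\<close>
      have "(\<Sum>p\<in>P. exp_hit_time G p j) = (\<Sum>p\<in>P. 1 + exp_hit_time G v j)"
        using j disjoint verts_G by (intro sum.cong) (auto intro!: exp_hit_time_from_pendant)
      then have "lap_op G (\<lambda>x. exp_hit_time G x j) v
          = lap_op G1 (\<lambda>x. exp_hit_time G x j) v - real (card P)"
        by (simp add: lap_op_def nbrs_center deg_center sum.union_disjoint nbrs_center_disjoint
            H.finite_nbrs finite_P algebra_simps)
      moreover have "lap_op G (\<lambda>x. exp_hit_time G x j) v = real (deg G v)"
        using u j v True verts_G by (simp add: lap_op_exp_hit_time)
      ultimately show ?thesis
        using True by (simp add: deg_center)
    qed
    ultimately show ?thesis by simp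
  qed
  moreover have "exp_hit_time G j j = h j j + c * (h j j - h j v + h j v)"
    by (simp add: h_def exp_hit_time_self)
  ultimately have "exp_hit_time G v j = h v j + c * (h v j - h v v + h j v)"
    by (rule H.lap_op_unique[OF j v])
  also have "h v j - h v v + h j v = 2 * m * eff_resistance G1 v j"
    using H.eff_resistance_eq_commute_time[OF v j] by (simp add: h_def m_def exp_hit_time_self)
  finally show ?thesis
    using m by (simp add: c_def h_def)
qed

lemma kemeny_pendant_extension:
  "kemeny G = (real (num_edges G1) * kemeny G1 + real (card P) * moment G1 v
      + real (card P) * (real (num_edges G1) + real (card P) - 1 / 2))
    / (real (num_edges G1) + real (card P))"
proof -
  define m where "m = real (num_edges G1)"
  define k where "k = real (card P)"
  have mk: "m + k > 0"
    unfolding m_def k_def using H.num_edges_pos by simp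
  \<comment> \<open>The excursion formula produces r(v,j), whereas \<open>moment\<close> sums
    r(j,v).\<close>
  have res_sym: "eff_resistance G1 v j = eff_resistance G1 j v" if "j \<in> pverts G1" for j
  proof -
    have "2 * m * eff_resistance G1 v j = 2 * m * eff_resistance G1 j v"
      using H.eff_resistance_eq_commute_time[OF v that] H.eff_resistance_eq_commute_time[OF that v]
      by (simp add: m_def)
    then show ?thesis
      using H.num_edges_pos by (simp add: m_def)
  qed
  have "2 * (m + k) * kemeny G = (\<Sum>j\<in>pverts G. real (deg G j) * exp_hit_time G v j)"
    using kemeny_eq[of v] v verts_G by (simp add: m_def k_def num_edges_G)
  \<comment> \<open>The additional weight at \<open>v\<close> disappears because the walk starts
    there and h(v,v) = 0.\<close>
  also have "\<dots> = (\<Sum>j\<in>pverts G1. real (deg G1 j) * exp_hit_time G v j) + (\<Sum>p\<in>P. exp_hit_time G v p)"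
    by (simp add: sum_deg_mult exp_hit_time_self)
  also have "(\<Sum>p\<in>P. exp_hit_time G v p) = k * (2 * (m + k) - 1)"
    by (simp add: exp_hit_time_to_pendant num_edges_G m_def k_def)
  also have "(\<Sum>j\<in>pverts G1. real (deg G1 j) * exp_hit_time G v j)
      = (\<Sum>j\<in>pverts G1. real (deg G1 j) * exp_hit_time G1 v j
          + 2 * k * (real (deg G1 j) * eff_resistance G1 j v))"
    by (intro sum.cong) (auto simp: exp_hit_time_to_old res_sym k_def algebra_simps)
  also have "\<dots> = 2 * m * kemeny G1 + 2 * k * moment G1 v"
    using H.kemeny_eq[OF v] by (simp add: sum.distrib moment_def m_def sum_distrib_left)
  finally have "(m + k) * kemeny G = m * kemeny G1 + k * moment G1 v + k * (m + k - 1 / 2)"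
    by (simp add: algebra_simps)
  then show ?thesis
    using mk by (simp add: m_def k_def field_simps)
qed

end

theorem theorem4p5:
  fixes G G1 S :: "'a pair_pre_digraph" and v :: 'a and k m1 :: nat
  assumes "pair_graph G1"
    and "Digraph_Component.connected (with_proj G1)"
    and "m1 = num_edges G1"
    and "m1 \<ge> 1"
    and "v \<in> pverts G1"
    and "k \<ge> 1"
    and "is_star S v"
    and "card (pverts S) = k + 1"
    and "is_one_sum G G1 v S"
  shows "kemeny G =
    (real m1 * kemeny G1 + real k * moment G1 v + real k * (real m1 + real k - 1 / 2))
      / (real m1 + real k)"
proof -
  define P where "P = pverts S - {v}"
  have S: "finite (pverts S)" "v \<in> pverts S" "parcs S = {v} \<times> P \<union> P \<times> {v}"
    using assms(7) by (auto simp: is_star_def P_def)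
  have G: "pverts G1 \<inter> pverts S = {v}" "pverts G = pverts G1 \<union> pverts S" "parcs G = parcs G1 \<union> parcs S"
    using assms(9) by (auto simp: is_one_sum_def)
  have "card P = k"
    using S assms(8) by (simp add: P_def)
  \<comment> \<open>An edge supplies the arc that the locale demands.\<close>
  have "parcs G1 \<noteq> {}"
    using assms(3,4) by (auto simp: num_edges_def)
  then interpret H: connected_simple_graph G1
    using assms(1,2) by (intro pair_graph_connected_simple_graph)
  interpret pendant_extension G1 G v P
    using S G assms(5) by unfold_locales (auto simp: P_def)
  show ?thesis
    using kemeny_pendant_extension \<open>card P = k\<close> assms(3) by simp
qed

end
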